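(* Let $S_n=(S_n^x,S_n^y)$, $n\ge 0$, be the simple random walk on the 2-dimensional comb $\mathbf C_2$ started at $S_0=(0,0)$, and let $D_n^x=\max\{|S_i^x|:0\le i\le n\}$. Then $$\mathbb E[D_n^x]\sim\frac{2^{-7/4}\,\pi}{\Gamma(5/4)}\,n^{1/4}\qquad (n\to\infty).$$
   Context: The 2-dimensional comb $\mathbf C_2$ is the graph with vertex set $\mathbb Z^2$ obtained from the usual square lattice by removing all horizontal edges off the $x$-axis: $(x,y)$ is adjacent to $(x,y\pm1)$ for all $x,y\in\mathbb Z$, and $(x,0)$ is adjacent to $(x\pm1,0)$ for all $x\in\mathbb Z$. The simple random walk moves at each step to a uniformly chosen neighbour of the current vertex (transition probabilities $1/4$ from vertices on the $x$-axis and $1/2$ from other vertices). $a_n\sim b_n$ means $a_n/b_n\to1$, and $\Gamma$ is the Euler gamma function. *)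

theory Defs
  imports "HOL-Probability.Probability" "HOL-Library.Landau_Symbols"
begin

fun comb_adj :: "int \<times> int \<Rightarrow> int \<times> int \<Rightarrow> bool" where
  "comb_adj (x, y) (x', y') \<longleftrightarrow>
     x' = x \<and> (y' = y + 1 \<or> y' = y - 1) \<or>
     y = 0 \<and> y' = 0 \<and> (x' = x + 1 \<or> x' = x - 1)"

lemma comb_neighbours:
  "{v. comb_adj (x, y) v} =
     (if y = 0 then {(x, 1), (x, -1), (x + 1, 0), (x - 1, 0)} else {(x, y + 1), (x, y - 1)})"
  by (auto split: if_splits)

lemma comb_neighbours_finite: "finite {v. comb_adj u v}"
  by (cases u) (simp add: comb_neighbours)

lemma comb_neighbours_nonempty: "{v. comb_adj u v} \<noteq> {}"
  by (cases u) (simp add: comb_neighbours)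

lemma comb_degree: "card {v. comb_adj (x, y) v} = (if y = 0 then 4 else 2)"
  by (simp add: comb_neighbours)

lemma comb_adj_sym: "comb_adj u v \<longleftrightarrow> comb_adj v u"
  by (cases u; cases v) auto

text \<open>
  The graph is given by its adjacency relation \<open>E\<close>.  It must be locally finite without isolated
  vertices for \<^const>\<open>pmf_of_set\<close> to be the uniform distribution on the set of neighbours.
  The positivity premise excludes histories on which the conditional probability is undefined
  mathematically (and equal to 0 in the library).
\<close>

locale simple_random_walk = prob_space M
  for M :: "'w measure"
    and E :: "'v \<Rightarrow> 'v \<Rightarrow> bool"
    and v\<^sub>0 :: 'v
    and S :: "nat \<Rightarrow> 'w \<Rightarrow> 'v" +
  assumes locally_finite: "finite {v. E u v}"
    and no_isolated: "{v. E u v} \<noteq> {}"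
    and walk_measurable: "S n \<in> M \<rightarrow>\<^sub>M count_space UNIV"
    and walk_start: "AE \<omega> in M. S 0 \<omega> = v\<^sub>0"
    and walk_step:
      "\<P>(\<omega> in M. \<forall>i\<le>n. S i \<omega> = p i) > 0 \<Longrightarrow>
       \<P>(\<omega> in M. S (Suc n) \<omega> = v \<bar> \<forall>i\<le>n. S i \<omega> = p i) = pmf (pmf_of_set {v. E (p n) v}) v"

definition max_horizontal :: "(nat \<Rightarrow> 'w \<Rightarrow> int \<times> int) \<Rightarrow> nat \<Rightarrow> 'w \<Rightarrow> int" where
  "max_horizontal S n \<omega> = Max {\<bar>fst (S i \<omega>)\<bar> | i. i \<le> n}"

end

theory Submission
  imports Defs "HOL-Real_Asymp.Real_Asymp"
begin

text \<open>
  Let \<open>T\<^sub>k\<close> be the first time at which the walk is at horizontal distance \<open>k\<close> from the origin.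
  Then \<open>E[D\<^sub>n]\<close> is the sum over \<open>k \<ge> 1\<close> of the probabilities of \<open>T\<^sub>k \<le> n\<close>, so the increments of
  \<open>E[D\<^sub>n]\<close> have as generating function the sum over \<open>k\<close> of \<open>E[z ^ T\<^sub>k]\<close>.

  This last quantity is explicit.  For \<open>0 < z < 1\<close> put \<open>s = sqrt (1 - z\<^sup>2)\<close>,
  \<open>\<alpha> = (1 - s) / z\<close> and choose \<open>\<theta> > 0\<close> with \<open>cosh \<theta> = (1 + s) / z\<close>.  The function
  \<open>h (x, y) = cosh (\<theta> x) * \<alpha> ^ \<bar>y\<bar>\<close> is an eigenfunction of the walk with eigenvalue
  \<open>1 / z\<close> (\<open>comb_eigen_harmonic\<close>), so \<open>z ^ n * h (S n)\<close> is a martingale.  The horizontal coordinate changes only on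
  the backbone, so \<open>h\<close> takes the value \<open>cosh (k \<theta>)\<close> at time \<open>T\<^sub>k\<close>, and optional stopping gives
  \<open>E[z ^ T\<^sub>k] = 1 / cosh (k \<theta>)\<close> (\<open>exit_time_gf\<close>).

  For \<open>z = exp (- t)\<close> and \<open>t\<close> decreasing to 0, \<open>\<theta>\<close> is asymptotic to \<open>2 powr (3/4) * t powr (1/4)\<close>, and the sum
  over \<open>k\<close> is \<open>1 / \<theta>\<close> times a Riemann sum for the integral of \<open>1 / cosh\<close> over the half-line, which equals
  \<open>\<pi> / 2\<close>.  Hence the generating function is asymptotic to
  \<open>2 powr (- 7/4) * \<pi> * t powr (- 1/4)\<close> (\<open>mean_increment_laplace_asymp\<close>).  The increments are
  nonnegative, so Karamata's Tauberian theorem with exponent \<open>1/4\<close> (\<open>karamata_tauberian\<close>)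
  turns this into the asymptotics of their partial sums \<open>E[D\<^sub>n]\<close>.

  Karamata's theorem is proved by comparison with the coefficients of \<open>(1 - z) powr (- \<rho>)\<close>, for which it
  amounts to Euler's product for the Gamma function, together with Weierstrass approximation.
\<close>

section \<open>Karamata's Tauberian theorem\<close>

text \<open>
  Multiplying the \<open>k\<close>-th term by \<open>exp (- t k) ^ i\<close> only replaces \<open>t\<close> by \<open>(i + 1) t\<close>, so a polynomial
  weight turns the transform into a linear combination of its values at rescaled points.
\<close>

lemma laplace_null_polynomial:
  fixes e :: "nat \<Rightarrow> real" and \<rho> :: real
  assumes sum_e: "\<And>t. t > 0 \<Longrightarrow> summable (\<lambda>k. e k * exp (- t * real k))"
    and lim: "((\<lambda>t. t powr \<rho> * (\<Sum>k. e k * exp (- t * real k))) \<longlongrightarrow> 0) (at_right 0)"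
  shows "((\<lambda>t. t powr \<rho> * (\<Sum>k. e k * exp (- t * real k) * (\<Sum>i\<le>m. a i * exp (- t * real k) ^ i))) \<longlongrightarrow> 0)
           (at_right 0)"
proof -
  define F where "F t = (\<Sum>k. e k * exp (- t * real k))" for t
  have limi: "((\<lambda>t. t powr \<rho> * F (real (Suc i) * t)) \<longlongrightarrow> 0) (at_right 0)" for i
  proof -
    have "filterlim (\<lambda>t. real (Suc i) * t) (at_right 0) (at_right 0)"
      by real_asymp
    with lim have "((\<lambda>t. (real (Suc i) * t) powr \<rho> * F (real (Suc i) * t)) \<longlongrightarrow> 0) (at_right 0)"
      unfolding F_def by (rule filterlim_compose[where g = "\<lambda>t. t powr \<rho> * _ t"])
    hence "((\<lambda>t. real (Suc i) powr (-\<rho>) * ((real (Suc i) * t) powr \<rho> * F (real (Suc i) * t)))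
             \<longlongrightarrow> real (Suc i) powr (-\<rho>) * 0) (at_right 0)"
      by (intro tendsto_intros)
    moreover have "\<forall>\<^sub>F t in at_right 0. real (Suc i) powr (-\<rho>) * ((real (Suc i) * t) powr \<rho> * F (real (Suc i) * t))
        = t powr \<rho> * F (real (Suc i) * t)"
      using eventually_at_right_less[of 0]
    proof eventually_elim
      case (elim t)
      have "real (Suc i) powr (-\<rho>) * (real (Suc i) * t) powr \<rho> = t powr \<rho>"
        using elim by (simp add: powr_mult powr_minus field_simps del: of_nat_Suc)
      thus ?case by (metis mult.assoc)
    qed
    ultimately show ?thesis by (simp only: tendsto_cong mult_zero_right)
  qed
  have "((\<lambda>t. \<Sum>i\<le>m. a i * (t powr \<rho> * F (real (Suc i) * t))) \<longlongrightarrow> (\<Sum>i\<le>m. a i * 0)) (at_right 0)"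
    by (intro tendsto_intros limi)
  moreover have "\<forall>\<^sub>F t in at_right 0. (\<Sum>i\<le>m. a i * (t powr \<rho> * F (real (Suc i) * t))) =
      t powr \<rho> * (\<Sum>k. e k * exp (- t * real k) * (\<Sum>i\<le>m. a i * exp (- t * real k) ^ i))"
    using eventually_at_right_less[of 0]
  proof eventually_elim
    case (elim t)
    have pw: "e k * exp (- t * real k) * (a i * exp (- t * real k) ^ i)
        = a i * (e k * exp (- (real (Suc i) * t) * real k))" for k i
    proof -
      have "exp (- t * real k) * exp (- t * real k) ^ i = exp (- t * real k) ^ Suc i"
        by simp
      also have "\<dots> = exp (- (real (Suc i) * t) * real k)"
        by (simp only: exp_of_nat_mult[symmetric]) (simp add: algebra_simps)
      finally show ?thesis by (simp only: mult_ac)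
    qed
    have sm: "summable (\<lambda>k. a i * (e k * exp (- (real (Suc i) * t) * real k)))" for i
      by (intro summable_mult sum_e) (use elim in auto)
    have "(\<Sum>k. e k * exp (- t * real k) * (\<Sum>i\<le>m. a i * exp (- t * real k) ^ i))
        = (\<Sum>k. \<Sum>i\<le>m. a i * (e k * exp (- (real (Suc i) * t) * real k)))"
      by (simp only: sum_distrib_left pw)
    also have "\<dots> = (\<Sum>i\<le>m. \<Sum>k. a i * (e k * exp (- (real (Suc i) * t) * real k)))"
      by (rule suminf_sum) (rule sm)
    also have "\<dots> = (\<Sum>i\<le>m. a i * F (real (Suc i) * t))"
      unfolding F_def using elim by (intro sum.cong refl suminf_mult sum_e) auto
    finally show ?case by (simp add: sum_distrib_left mult_ac)
  qed
  ultimately show ?thesis by (simp add: tendsto_cong)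
qed

text \<open>
  Weierstrass approximation: replacing \<open>f\<close> by a uniformly close polynomial changes the weighted sum
  by at most a small multiple of the transform of the dominating sequence \<open>w\<close>, which is
  \<open>O(t powr - \<rho>)\<close>.
\<close>

lemma laplace_null_continuous:
  fixes e w :: "nat \<Rightarrow> real" and \<rho> B :: real
  assumes dom: "\<And>k. \<bar>e k\<bar> \<le> w k"
    and sum_w: "\<And>t. t > 0 \<Longrightarrow> summable (\<lambda>k. w k * exp (- t * real k))"
    and bound: "\<forall>\<^sub>F t in at_right 0. t powr \<rho> * (\<Sum>k. w k * exp (- t * real k)) \<le> B"
    and lim: "((\<lambda>t. t powr \<rho> * (\<Sum>k. e k * exp (- t * real k))) \<longlongrightarrow> 0) (at_right 0)"
    and cont: "continuous_on {0..1} f"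
  shows "((\<lambda>t. t powr \<rho> * (\<Sum>k. e k * exp (- t * real k) * f (exp (- t * real k)))) \<longlongrightarrow> 0) (at_right 0)"
proof (rule tendstoI)
  fix \<epsilon> :: real assume "\<epsilon> > 0"
  have wnn: "w k \<ge> 0" for k using dom[of k] by linarith
  define \<delta> where "\<delta> = \<epsilon> / (2 * (\<bar>B\<bar> + 1))"
  have "\<delta> > 0" unfolding \<delta>_def using \<open>\<epsilon> > 0\<close> by simp
  obtain p where p: "real_polynomial_function p" "\<And>x. x \<in> {0..1} \<Longrightarrow> \<bar>f x - p x\<bar> < \<delta>"
    using Stone_Weierstrass_real_polynomial_function[OF compact_Icc cont \<open>\<delta> > 0\<close>] by blast
  obtain a m where pa: "p = (\<lambda>x. \<Sum>i\<le>m. a i * x ^ i)"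
    using p(1) real_polynomial_function_iff_sum by metis
  have sum_g: "summable (\<lambda>k. e k * exp (- t * real k) * g (exp (- t * real k)))"
    if "t > 0" "\<And>x. x \<in> {0..1} \<Longrightarrow> \<bar>g x\<bar> \<le> C" for g C t
  proof (rule summable_comparison_test')
    show "summable (\<lambda>k. C * (w k * exp (- t * real k)))"
      using that by (intro summable_mult sum_w)
    fix k
    have "exp (- t * real k) \<in> {0..1}" using that(1) by simp
    hence "\<bar>e k\<bar> * exp (- t * real k) * \<bar>g (exp (- t * real k))\<bar> \<le> w k * exp (- t * real k) * C"
      using dom[of k] that by (intro mult_mono) auto
    thus "norm (e k * exp (- t * real k) * g (exp (- t * real k))) \<le> C * (w k * exp (- t * real k))"
      by (simp add: abs_mult mult_ac)
  qed
  have "\<exists>C. \<forall>x\<in>{0..1}. \<bar>h x\<bar> \<le> C" if "continuous_on {0..1} h" for h :: "real \<Rightarrow> real"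
    using compact_imp_bounded[OF compact_continuous_image[OF that compact_Icc]]
    by (auto simp: bounded_iff)
  then obtain C where C: "\<And>x. x \<in> {0..1} \<Longrightarrow> \<bar>f x\<bar> \<le> C" using cont by metis
  have Cp: "\<bar>p x\<bar> \<le> C + \<delta>" if "x \<in> {0..1}" for x
    using C[OF that] p(2)[OF that] by linarith
  have sum_e: "summable (\<lambda>k. e k * exp (- t * real k))" if "t > 0" for t
    using sum_g[of t "\<lambda>_. 1" 1] that by simp
  have "\<forall>\<^sub>F t in at_right 0. dist (t powr \<rho> * (\<Sum>k. e k * exp (- t * real k) * p (exp (- t * real k)))) 0 < \<epsilon> / 2"
    unfolding pa by (rule tendstoD[OF laplace_null_polynomial[OF sum_e lim]]) (use \<open>\<epsilon> > 0\<close> in auto)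
  with bound eventually_at_right_less[of 0]
  show "\<forall>\<^sub>F t in at_right 0. dist (t powr \<rho> * (\<Sum>k. e k * exp (- t * real k) * f (exp (- t * real k)))) 0 < \<epsilon>"
  proof eventually_elim
    case (elim t)
    let ?W = "\<Sum>k. w k * exp (- t * real k)"
    let ?P = "\<Sum>k. e k * exp (- t * real k) * p (exp (- t * real k))"
    let ?F = "\<Sum>k. e k * exp (- t * real k) * f (exp (- t * real k))"
    have "?F - ?P = (\<Sum>k. e k * exp (- t * real k) * f (exp (- t * real k)) - e k * exp (- t * real k) * p (exp (- t * real k)))"
      by (rule suminf_diff) (use sum_g[OF _ C] sum_g[OF _ Cp] elim in auto)
    also have "\<bar>\<dots>\<bar> \<le> (\<Sum>k. \<delta> * (w k * exp (- t * real k)))"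
    proof (rule norm_suminf_le[where 'a = real, unfolded real_norm_def])
      show "summable (\<lambda>k. \<delta> * (w k * exp (- t * real k)))"
        using elim by (intro summable_mult sum_w) auto
      fix k
      have "exp (- t * real k) \<in> {0..1}" using elim by simp
      from p(2)[OF this] have
        "\<bar>e k\<bar> * exp (- t * real k) * \<bar>f (exp (- t * real k)) - p (exp (- t * real k))\<bar> \<le> w k * exp (- t * real k) * \<delta>"
        using dom[of k] \<open>\<delta> > 0\<close> wnn[of k] by (intro mult_mono) auto
      thus "\<bar>e k * exp (- t * real k) * f (exp (- t * real k)) - e k * exp (- t * real k) * p (exp (- t * real k))\<bar>
          \<le> \<delta> * (w k * exp (- t * real k))"
        by (simp add: abs_mult mult_ac flip: right_diff_distrib)
    qed
    also have "\<dots> = \<delta> * ?W"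
      using elim by (intro suminf_mult sum_w) auto
    finally have "t powr \<rho> * \<bar>?F - ?P\<bar> \<le> t powr \<rho> * (\<delta> * ?W)"
      by (intro mult_left_mono) auto
    also have "\<dots> = \<delta> * (t powr \<rho> * ?W)" by simp
    also have "\<dots> \<le> \<delta> * B" using elim \<open>\<delta> > 0\<close> by (intro mult_left_mono) auto
    also have "\<dots> \<le> \<delta> * (\<bar>B\<bar> + 1)" using \<open>\<delta> > 0\<close> by (intro mult_left_mono) auto
    also have "\<dots> = \<epsilon> / 2" unfolding \<delta>_def by (simp add: field_simps add_pos_nonneg)
    finally have "\<bar>t powr \<rho> * ?F - t powr \<rho> * ?P\<bar> \<le> \<epsilon> / 2"
      by (simp add: abs_mult flip: right_diff_distrib)
    moreover have "\<bar>t powr \<rho> * ?P\<bar> < \<epsilon> / 2" using elim by (simp only: dist_real_def diff_0_right)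
    ultimately show ?case unfolding dist_real_def diff_0_right by linarith
  qed
qed

text \<open>
  With \<open>exp (- t k) * f (exp (- t k))\<close> as weights, a partial sum is squeezed between two
  transforms with continuous \<open>f\<close>.  Here \<open>x * f x\<close> is the piecewise linear ramp from 0 at \<open>exp (- b)\<close>
  to 1 at \<open>exp (- a)\<close>; dividing it by \<open>max x (exp (- b))\<close> in place of \<open>x\<close> changes nothing where
  the ramp is nonzero and avoids the singularity at 0.
\<close>

lemma continuous_cutoff:
  fixes a b :: real
  assumes "a < b"
  obtains f where "continuous_on UNIV f"
    "\<And>t. of_bool (t \<le> a) \<le> exp (- t) * f (exp (- t))"
    "\<And>t. exp (- t) * f (exp (- t)) \<le> of_bool (t \<le> (b::real))"
proof -
  define r where "r x = max 0 (min 1 ((x - exp (- b)) / (exp (- a) - exp (- b))))" for x :: real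
  have pos: "exp (- a) - exp (- b) > 0" using assms by simp
  define f where "f x = r x / max x (exp (- b))" for x
  have eq: "exp (- t) * f (exp (- t)) = r (exp (- t))" for t
  proof (cases "t \<le> b")
    case False
    hence "r (exp (- t)) = 0" using pos unfolding r_def by (auto simp: max_def min_def field_simps)
    thus ?thesis by (simp add: f_def)
  qed (auto simp: f_def max_def)
  show ?thesis
  proof
    show "continuous_on UNIV f" unfolding f_def r_def using pos
      by (intro continuous_intros) (auto simp: max_def not_less)
    show "of_bool (t \<le> a) \<le> exp (- t) * f (exp (- t))" for t
    proof (cases "t \<le> a")
      case True
      hence "(exp (- t) - exp (- b)) / (exp (- a) - exp (- b)) \<ge> 1" using pos by (simp add: field_simps)
      thus ?thesis unfolding eq by (simp add: r_def)
    qed (simp add: eq r_def)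
    show "exp (- t) * f (exp (- t)) \<le> of_bool (t \<le> b)" for t
    proof (cases "t \<le> b")
      case False
      hence "(exp (- t) - exp (- b)) / (exp (- a) - exp (- b)) \<le> 0" using pos by (simp add: field_simps)
      thus ?thesis unfolding eq using False by (simp add: r_def)
    qed (simp add: eq r_def)
  qed
qed

text \<open>
  At \<open>t = 1 / n\<close> a cutoff at \<open>a\<close> in the variable \<open>t k\<close> becomes a cutoff at \<open>a n\<close> in \<open>k\<close>.
\<close>

lemma cutoff_sum_bounds:
  fixes \<delta> :: "nat \<Rightarrow> real"
  assumes nn: "\<And>k. \<delta> k \<ge> 0" and n: "n > 0" and "a \<ge> 0" "b \<ge> 0"
    and lo: "\<And>t. of_bool (t \<le> a) \<le> exp (- t) * f (exp (- t))"
    and hi: "\<And>t. exp (- t) * f (exp (- t)) \<le> of_bool (t \<le> (b::real))"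
  defines "T \<equiv> (\<lambda>k. \<delta> k * exp (- (1 / real n) * real k) * f (exp (- (1 / real n) * real k)))"
  shows "summable T" "(\<Sum>k\<le>nat \<lfloor>a * real n\<rfloor>. \<delta> k) \<le> suminf T"
    "suminf T \<le> (\<Sum>k\<le>nat \<lfloor>b * real n\<rfloor>. \<delta> k)"
proof -
  have iff: "real k / real n \<le> c \<longleftrightarrow> k \<le> nat \<lfloor>c * real n\<rfloor>" if "c \<ge> 0" for k and c :: real
    using n that by (simp add: le_nat_iff le_floor_iff field_simps)
  have T: "T k = \<delta> k * (exp (- (real k / real n)) * f (exp (- (real k / real n))))" for k
    by (simp add: T_def)
  have lo': "\<delta> k * of_bool (k \<le> nat \<lfloor>a * real n\<rfloor>) \<le> T k" for k
    unfolding T using lo[of "real k / real n"] nn[of k] iff[OF \<open>a \<ge> 0\<close>]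
    by (intro mult_left_mono) auto
  have hi': "T k \<le> \<delta> k * of_bool (k \<le> nat \<lfloor>b * real n\<rfloor>)" for k
    unfolding T using hi[of "real k / real n"] nn[of k] iff[OF \<open>b \<ge> 0\<close>]
    by (intro mult_left_mono) auto
  have nnT: "T k \<ge> 0" for k using lo'[of k] nn[of k] by (smt (verit) mult_nonneg_nonneg of_bool_def)
  have z: "T k = 0" if "k \<notin> {..nat \<lfloor>b * real n\<rfloor>}" for k
    using hi'[of k] nnT[of k] that by (simp add: not_le)
  show sm: "summable T" by (rule summable_finite[OF finite_atMost z])
  have "(\<Sum>k\<le>nat \<lfloor>a * real n\<rfloor>. \<delta> k) \<le> (\<Sum>k\<le>nat \<lfloor>a * real n\<rfloor>. T k)"
  proof (rule sum_mono)
    fix k assume "k \<in> {..nat \<lfloor>a * real n\<rfloor>}"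
    thus "\<delta> k \<le> T k" using lo'[of k] by simp
  qed
  also have "\<dots> \<le> suminf T" by (rule sum_le_suminf[OF sm]) (auto simp: nnT)
  finally show "(\<Sum>k\<le>nat \<lfloor>a * real n\<rfloor>. \<delta> k) \<le> suminf T" .
  have "suminf T = (\<Sum>k\<le>nat \<lfloor>b * real n\<rfloor>. T k)" by (rule suminf_finite[OF finite_atMost z])
  also have "\<dots> \<le> (\<Sum>k\<le>nat \<lfloor>b * real n\<rfloor>. \<delta> k)"
  proof (rule sum_mono)
    fix k assume "k \<in> {..nat \<lfloor>b * real n\<rfloor>}"
    thus "T k \<le> \<delta> k" using hi'[of k] by simp
  qed
  finally show "suminf T \<le> (\<Sum>k\<le>nat \<lfloor>b * real n\<rfloor>. \<delta> k)" .
qed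

text \<open>
  The coefficients of \<open>(1 - z) powr (- \<rho>)\<close> serve as the model sequence in Karamata's theorem:
  both their transform and the growth of their partial sums are known explicitly.  Summation
  multiplies the generating function by \<open>1 / (1 - z)\<close>, that is, it raises \<open>\<rho>\<close> by one.
\<close>

lemma sum_pochhammer_fact:
  fixes \<rho> :: real
  shows "(\<Sum>k\<le>n. pochhammer \<rho> k / fact k) = pochhammer (\<rho> + 1) n / fact n"
proof (induction n)
  case (Suc n)
  have "pochhammer \<rho> (Suc n) = \<rho> * pochhammer (\<rho> + 1) n" by (rule pochhammer_rec)
  moreover have "pochhammer (\<rho> + 1) (Suc n) = pochhammer (\<rho> + 1) n * (\<rho> + 1 + real n)"
    by (rule pochhammer_Suc)
  ultimately have "pochhammer \<rho> (Suc n) / fact (Suc n) + pochhammer (\<rho> + 1) n / fact n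
      = pochhammer (\<rho> + 1) (Suc n) / fact (Suc n)"
    by (simp add: divide_simps del: pochhammer_Suc) (simp add: algebra_simps)
  thus ?case using Suc.IH by simp
qed simp

text \<open>
  By the previous identity the partial sums are reciprocals of Euler's product for the Gamma
  function.
\<close>

lemma pochhammer_partial_sums_asymp:
  fixes \<rho> :: real
  assumes "\<rho> > 0"
  shows "(\<lambda>n. (\<Sum>k\<le>n. pochhammer \<rho> k / fact k) / real n powr \<rho>) \<longlonglongrightarrow> 1 / Gamma (1 + \<rho>)"
proof -
  have G: "Gamma \<rho> \<noteq> 0" using Gamma_real_pos[OF assms] by simp
  have "(\<lambda>n. 1 / (\<rho> * Gamma_series \<rho> n)) \<longlonglongrightarrow> 1 / (\<rho> * Gamma \<rho>)"
    using G assms by (intro tendsto_intros Gamma_series_LIMSEQ) auto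
  moreover have "\<forall>\<^sub>F n in sequentially. 1 / (\<rho> * Gamma_series \<rho> n)
      = (\<Sum>k\<le>n. pochhammer \<rho> k / fact k) / real n powr \<rho>"
    using eventually_gt_at_top[of 0]
  proof eventually_elim
    case (elim n)
    have "pochhammer \<rho> (Suc n) = \<rho> * pochhammer (\<rho> + 1) n" by (rule pochhammer_rec)
    thus ?case using elim assms
      unfolding sum_pochhammer_fact Gamma_series_def by (simp add: powr_def field_simps)
  qed
  moreover have "Gamma (1 + \<rho>) = \<rho> * Gamma \<rho>"
    using Gamma_plus1[of \<rho>] assms by (simp add: add.commute nonpos_Ints_def)
  ultimately show ?thesis by (simp add: tendsto_cong)
qed

lemma pochhammer_laplace:
  fixes \<rho> t :: real
  assumes "t > 0"
  shows "(\<lambda>k. pochhammer \<rho> k / fact k * exp (- t * real k)) sums ((1 - exp (- t)) powr (- \<rho>))"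
proof -
  have "(\<lambda>k. (- \<rho> gchoose k) * (- exp (- t)) ^ k) sums ((1 + (- exp (- t))) powr (- \<rho>))"
    by (rule gen_binomial_real) (use assms in auto)
  moreover have "(- \<rho> gchoose k) * (- exp (- t)) ^ k = pochhammer \<rho> k / fact k * exp (- t * real k)" for k
  proof -
    have "(- exp (- t)) ^ k = (-1) ^ k * exp (- t * real k)"
      by (subst power_minus) (simp add: exp_of_nat_mult[symmetric] mult.commute)
    thus ?thesis by (simp add: gbinomial_pochhammer mult.assoc flip: power_mult_distrib)
  qed
  ultimately show ?thesis by simp
qed

text \<open>
  The difference \<open>e\<close> of \<open>d\<close> and \<open>c\<close> times the model sequence \<open>r\<close> has a transform of size
  \<open>o(t powr - \<rho>)\<close>, so the smoothed partial sums of the two sequences agree up to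
  \<open>o(n powr \<rho>)\<close>.  Nonnegativity lets the sharp partial sum up to \<open>n\<close> of one sequence be
  squeezed between those of the other up to \<open>a n\<close> and \<open>b n\<close>, for any \<open>a < 1 < b\<close>; the model
  sequence has partial sums of known size, and \<open>a\<close> and \<open>b\<close> tend to 1.
\<close>

theorem karamata_tauberian:
  fixes d :: "nat \<Rightarrow> real" and \<rho> c :: real
  assumes "\<rho> > 0" and nn: "\<And>k. d k \<ge> 0"
    and sum_d: "\<And>t. t > 0 \<Longrightarrow> summable (\<lambda>k. d k * exp (- t * real k))"
    and lim: "((\<lambda>t. t powr \<rho> * (\<Sum>k. d k * exp (- t * real k))) \<longlongrightarrow> c) (at_right 0)"
  shows "(\<lambda>n. (\<Sum>k\<le>n. d k) / real n powr \<rho>) \<longlonglongrightarrow> c / Gamma (1 + \<rho>)"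
proof -
  define r where "r k = pochhammer \<rho> k / fact k" for k
  define \<gamma> where "\<gamma> = 1 / Gamma (1 + \<rho>)"
  have rnn: "r k \<ge> 0" for k using \<open>\<rho> > 0\<close> by (simp add: r_def pochhammer_nonneg)
  have "\<forall>\<^sub>F t in at_right 0. 0 \<le> t powr \<rho> * (\<Sum>k. d k * exp (- t * real k))"
    using eventually_at_right_less[of 0]
    by eventually_elim (intro mult_nonneg_nonneg suminf_nonneg sum_d nn powr_ge_zero exp_ge_zero)
  hence c: "c \<ge> 0" by (intro tendsto_lowerbound[OF lim]) auto
  have sum_r: "summable (\<lambda>k. r k * exp (- t * real k))" if "t > 0" for t
    using pochhammer_laplace[OF that, of \<rho>] by (auto simp: r_def sums_iff)
  have lim_r: "((\<lambda>t. t powr \<rho> * (\<Sum>k. r k * exp (- t * real k))) \<longlongrightarrow> 1) (at_right 0)"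
  proof -
    have "((\<lambda>t::real. t powr \<rho> * (1 - exp (- t)) powr (- \<rho>)) \<longlongrightarrow> 1) (at_right 0)" by real_asymp
    moreover have "\<forall>\<^sub>F t in at_right 0. t powr \<rho> * (1 - exp (- t)) powr (- \<rho>)
        = t powr \<rho> * (\<Sum>k. r k * exp (- t * real k))"
      using eventually_at_right_less[of 0]
      by eventually_elim (use pochhammer_laplace[of _ \<rho>] in \<open>auto simp: r_def sums_iff\<close>)
    ultimately show ?thesis by (simp add: tendsto_cong)
  qed
  define e where "e k = d k - c * r k" for k
  define w where "w k = d k + c * r k" for k
  have sum_cr: "summable (\<lambda>k. c * (r k * exp (- t * real k)))" if "t > 0" for t
    by (intro summable_mult sum_r that)
  have dom: "\<bar>e k\<bar> \<le> w k" for k using nn[of k] rnn[of k] c by (auto simp: e_def w_def abs_le_iff)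
  have sum_w: "summable (\<lambda>k. w k * exp (- t * real k))" if "t > 0" for t
    using summable_add[OF sum_d[OF that] sum_cr[OF that]] by (simp add: w_def algebra_simps)
  have lap: "t powr \<rho> * (\<Sum>k. w k * exp (- t * real k)) =
      t powr \<rho> * (\<Sum>k. d k * exp (- t * real k)) + c * (t powr \<rho> * (\<Sum>k. r k * exp (- t * real k)))"
      "t powr \<rho> * (\<Sum>k. e k * exp (- t * real k)) =
      t powr \<rho> * (\<Sum>k. d k * exp (- t * real k)) - c * (t powr \<rho> * (\<Sum>k. r k * exp (- t * real k)))"
      if "t > 0" for t
  proof -
    have "(\<Sum>k. w k * exp (- t * real k)) = (\<Sum>k. d k * exp (- t * real k)) + c * (\<Sum>k. r k * exp (- t * real k))"
      unfolding suminf_mult[OF sum_r[OF that], of c, symmetric] suminf_add[OF sum_d[OF that] sum_cr[OF that]]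
      by (simp only: w_def distrib_right mult.assoc)
    thus "t powr \<rho> * (\<Sum>k. w k * exp (- t * real k)) =
      t powr \<rho> * (\<Sum>k. d k * exp (- t * real k)) + c * (t powr \<rho> * (\<Sum>k. r k * exp (- t * real k)))"
      by (simp only: distrib_left mult.left_commute)
    have "(\<Sum>k. e k * exp (- t * real k)) = (\<Sum>k. d k * exp (- t * real k)) - c * (\<Sum>k. r k * exp (- t * real k))"
      unfolding suminf_mult[OF sum_r[OF that], of c, symmetric] suminf_diff[OF sum_d[OF that] sum_cr[OF that]]
      by (simp only: e_def left_diff_distrib mult.assoc)
    thus "t powr \<rho> * (\<Sum>k. e k * exp (- t * real k)) =
      t powr \<rho> * (\<Sum>k. d k * exp (- t * real k)) - c * (t powr \<rho> * (\<Sum>k. r k * exp (- t * real k)))"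
      by (simp only: right_diff_distrib mult.left_commute)
  qed
  have lim_e: "((\<lambda>t. t powr \<rho> * (\<Sum>k. e k * exp (- t * real k))) \<longlongrightarrow> 0) (at_right 0)"
  proof -
    have "((\<lambda>t. t powr \<rho> * (\<Sum>k. d k * exp (- t * real k)) - c * (t powr \<rho> * (\<Sum>k. r k * exp (- t * real k))))
       \<longlongrightarrow> c - c * 1) (at_right 0)"
      by (intro tendsto_intros lim lim_r)
    moreover have "\<forall>\<^sub>F t in at_right 0. t powr \<rho> * (\<Sum>k. d k * exp (- t * real k)) - c * (t powr \<rho> * (\<Sum>k. r k * exp (- t * real k)))
        = t powr \<rho> * (\<Sum>k. e k * exp (- t * real k))"
      by (rule eventually_mono[OF eventually_at_right_less[of 0]]) (simp only: lap)
    ultimately show ?thesis by (simp add: tendsto_cong)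
  qed
  \<comment> \<open>The limit is \<open>2 * c\<close>; adding 1 leaves room for the convergence.\<close>
  have bound: "\<forall>\<^sub>F t in at_right 0. t powr \<rho> * (\<Sum>k. w k * exp (- t * real k)) \<le> 2 * c + 1"
  proof -
    have "((\<lambda>t. t powr \<rho> * (\<Sum>k. d k * exp (- t * real k)) + c * (t powr \<rho> * (\<Sum>k. r k * exp (- t * real k))))
       \<longlongrightarrow> c + c * 1) (at_right 0)"
      by (intro tendsto_intros lim lim_r)
    hence "\<forall>\<^sub>F t in at_right 0. t powr \<rho> * (\<Sum>k. d k * exp (- t * real k))
        + c * (t powr \<rho> * (\<Sum>k. r k * exp (- t * real k))) < 2 * c + 1"
      by (rule order_tendstoD(2)) simp
    with eventually_at_right_less[of 0] show ?thesis by eventually_elim (simp only: lap less_imp_le)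
  qed
  \<comment> \<open>The comparison is symmetric in the two sequences; both directions are used below.\<close>
  have cutoff: "\<exists>err. err \<longlonglongrightarrow> 0 \<and> (\<forall>n>0. (\<Sum>k\<le>nat \<lfloor>a * real n\<rfloor>. \<delta> k) / real n powr \<rho>
         \<le> err n + (\<Sum>k\<le>nat \<lfloor>b * real n\<rfloor>. \<delta>' k) / real n powr \<rho>)"
    if ab: "0 \<le> a" "a < b" and "(\<delta> = d \<and> \<delta>' = (\<lambda>k. c * r k)) \<or> (\<delta> = (\<lambda>k. c * r k) \<and> \<delta>' = d)" for a b \<delta> \<delta>'
  proof -
    obtain f where f: "continuous_on UNIV f"
      "\<And>t. of_bool (t \<le> a) \<le> exp (- t) * f (exp (- t))"
      "\<And>t. exp (- t) * f (exp (- t)) \<le> of_bool (t \<le> b)"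
      using continuous_cutoff[OF ab(2)] by blast
    define T where "T \<delta> n = (\<lambda>k. \<delta> k * exp (- (1 / real n) * real k) * f (exp (- (1 / real n) * real k)))" for \<delta> n
    define err where "err n = \<bar>(1 / real n) powr \<rho> * (\<Sum>k. T e n k)\<bar>" for n
    have "filterlim (\<lambda>n. 1 / real n) (at_right 0) sequentially" by real_asymp
    from filterlim_compose[OF laplace_null_continuous[OF dom sum_w bound lim_e continuous_on_subset[OF f(1)]] this]
    have "(\<lambda>n. (1 / real n) powr \<rho> * (\<Sum>k. T e n k)) \<longlonglongrightarrow> 0"
      by (simp add: T_def)
    hence "err \<longlonglongrightarrow> 0" unfolding err_def by (rule tendsto_rabs_zero)
    moreover have "(\<Sum>k\<le>nat \<lfloor>a * real n\<rfloor>. \<delta> k) / real n powr \<rho>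
         \<le> err n + (\<Sum>k\<le>nat \<lfloor>b * real n\<rfloor>. \<delta>' k) / real n powr \<rho>" if n: "n > 0" for n
    proof -
      have nn': "\<delta> k \<ge> 0" "\<delta>' k \<ge> 0" for k using \<open>_ \<or> _\<close> nn rnn c by auto
      have b: "b \<ge> 0" using ab by simp
      note B1 = cutoff_sum_bounds[of \<delta>, OF nn'(1) n ab(1) b f(2,3), folded T_def]
      note B2 = cutoff_sum_bounds[of \<delta>', OF nn'(2) n ab(1) b f(2,3), folded T_def]
      have "suminf (T \<delta> n) - suminf (T \<delta>' n) = (\<Sum>k. T \<delta> n k - T \<delta>' n k)"
        by (rule suminf_diff) (use B1(1) B2(1) in \<open>auto simp: T_def\<close>)
      also have "\<bar>\<dots>\<bar> = \<bar>\<Sum>k. T e n k\<bar>"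
      proof (cases "\<delta> = d")
        case True
        with \<open>_ \<or> _\<close> have "\<delta>' = (\<lambda>k. c * r k)" by auto
        hence "T \<delta> n k - T \<delta>' n k = T e n k" for k using True by (simp add: T_def e_def algebra_simps)
        thus ?thesis by simp
      next
        case False
        with \<open>_ \<or> _\<close> have eq: "\<delta> = (\<lambda>k. c * r k)" "\<delta>' = d" by auto
        have eq': "T \<delta> n k - T \<delta>' n k = - T e n k" for k using eq by (simp add: T_def e_def algebra_simps)
        have "summable (\<lambda>k. T \<delta> n k - T \<delta>' n k)"
          by (intro summable_diff) (use B1(1) B2(1) in \<open>auto simp: T_def\<close>)
        hence "summable (T e n)" unfolding eq' by (simp add: summable_minus_iff)
        thus ?thesis unfolding eq' by (simp add: suminf_minus)
      qed
      finally have "suminf (T \<delta> n) \<le> \<bar>\<Sum>k. T e n k\<bar> + suminf (T \<delta>' n)" by linarith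
      moreover have "(\<Sum>k\<le>nat \<lfloor>a * real n\<rfloor>. \<delta> k) \<le> suminf (T \<delta> n)" "suminf (T \<delta>' n) \<le> (\<Sum>k\<le>nat \<lfloor>b * real n\<rfloor>. \<delta>' k)"
        using B1(2) B2(3) by (auto simp: T_def)
      ultimately have "(\<Sum>k\<le>nat \<lfloor>a * real n\<rfloor>. \<delta> k) \<le> \<bar>\<Sum>k. T e n k\<bar> + (\<Sum>k\<le>nat \<lfloor>b * real n\<rfloor>. \<delta>' k)" by linarith
      hence "(\<Sum>k\<le>nat \<lfloor>a * real n\<rfloor>. \<delta> k) / real n powr \<rho> \<le> (\<bar>\<Sum>k. T e n k\<bar> + (\<Sum>k\<le>nat \<lfloor>b * real n\<rfloor>. \<delta>' k)) / real n powr \<rho>"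
        by (intro divide_right_mono) auto
      also have "\<dots> = err n + (\<Sum>k\<le>nat \<lfloor>b * real n\<rfloor>. \<delta>' k) / real n powr \<rho>"
        using n by (simp add: err_def add_divide_distrib abs_mult powr_divide)
      finally show ?thesis .
    qed
    ultimately show ?thesis by blast
  qed
  have lim_ref: "(\<lambda>n. (\<Sum>k\<le>nat \<lfloor>b * real n\<rfloor>. c * r k) / real n powr \<rho>) \<longlonglongrightarrow> c * b powr \<rho> * \<gamma>"
    if "b > 0" for b :: real
  proof -
    have top: "filterlim (\<lambda>n. nat \<lfloor>b * real n\<rfloor>) at_top sequentially" using that by real_asymp
    have q: "(\<lambda>n. real (nat \<lfloor>b * real n\<rfloor>) / real n) \<longlonglongrightarrow> b" using that by real_asymp
    have "(\<lambda>n. c * (real (nat \<lfloor>b * real n\<rfloor>) / real n) powr \<rho> *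
        ((\<Sum>k\<le>nat \<lfloor>b * real n\<rfloor>. r k) / real (nat \<lfloor>b * real n\<rfloor>) powr \<rho>)) \<longlonglongrightarrow> c * b powr \<rho> * \<gamma>"
    proof (intro tendsto_mult tendsto_const tendsto_powr q)
      show "(\<lambda>n. (\<Sum>k\<le>nat \<lfloor>b * real n\<rfloor>. r k) / real (nat \<lfloor>b * real n\<rfloor>) powr \<rho>) \<longlonglongrightarrow> \<gamma>"
        unfolding \<gamma>_def r_def by (rule filterlim_compose[OF pochhammer_partial_sums_asymp[OF \<open>\<rho> > 0\<close>] top])
    qed (use that in auto)
    moreover have "\<forall>\<^sub>F n in sequentially. c * (real (nat \<lfloor>b * real n\<rfloor>) / real n) powr \<rho> *
        ((\<Sum>k\<le>nat \<lfloor>b * real n\<rfloor>. r k) / real (nat \<lfloor>b * real n\<rfloor>) powr \<rho>) = (\<Sum>k\<le>nat \<lfloor>b * real n\<rfloor>. c * r k) / real n powr \<rho>"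
      using top[unfolded filterlim_at_top, rule_format, of 1]
    proof eventually_elim
      case (elim n)
      define m where "m = nat \<lfloor>b * real n\<rfloor>"
      have "m > 0" using elim unfolding m_def[symmetric] by simp
      hence "real m powr \<rho> \<noteq> 0" by simp
      thus ?case unfolding m_def[symmetric] sum_distrib_left[symmetric] by (simp add: powr_divide)
    qed
    ultimately show ?thesis by (simp add: tendsto_cong)
  qed
  have cont1: "((\<lambda>b. c * b powr \<rho> * \<gamma>) \<longlongrightarrow> c * \<gamma>) (at 1 within A)" for A
  proof -
    have "((\<lambda>b. c * b powr \<rho> * \<gamma>) \<longlongrightarrow> c * 1 powr \<rho> * \<gamma>) (at 1 within A)"
      by (intro tendsto_intros) auto
    thus ?thesis by simp
  qed
  have "(\<lambda>n. (\<Sum>k\<le>n. d k) / real n powr \<rho>) \<longlonglongrightarrow> c * \<gamma>"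
  proof (rule order_tendstoI)
    fix y assume "y > c * \<gamma>"
    from order_tendstoD(2)[OF cont1[of "{1<..}"] this] eventually_at_right_less[of 1]
    have "\<forall>\<^sub>F b in at_right 1. c * b powr \<rho> * \<gamma> < y \<and> b > 1" by eventually_elim simp
    then obtain b where b: "b > 1" "c * b powr \<rho> * \<gamma> < y"
      using eventually_happens[of _ "at_right (1::real)"] by auto
    obtain err where err: "err \<longlonglongrightarrow> 0" "\<And>n. n > 0 \<Longrightarrow> (\<Sum>k\<le>n. d k) / real n powr \<rho>
         \<le> err n + (\<Sum>k\<le>nat \<lfloor>b * real n\<rfloor>. c * r k) / real n powr \<rho>"
      using cutoff[of 1 b d "\<lambda>k. c * r k"] b by auto
    have "(\<lambda>n. err n + (\<Sum>k\<le>nat \<lfloor>b * real n\<rfloor>. c * r k) / real n powr \<rho>) \<longlonglongrightarrow> 0 + c * b powr \<rho> * \<gamma>"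
      using b by (intro tendsto_add err lim_ref) auto
    from order_tendstoD(2)[OF this, of y] b(2)
    have "\<forall>\<^sub>F n in sequentially. err n + (\<Sum>k\<le>nat \<lfloor>b * real n\<rfloor>. c * r k) / real n powr \<rho> < y" by simp
    with eventually_gt_at_top[of 0] show "\<forall>\<^sub>F n in sequentially. (\<Sum>k\<le>n. d k) / real n powr \<rho> < y"
    proof eventually_elim
      case (elim n)
      thus ?case using err(2)[of n] by linarith
    qed
  next
    fix y assume "y < c * \<gamma>"
    have "\<forall>\<^sub>F b in at_left 1. b \<in> {0<..<1::real}" by (rule eventually_at_leftI[of 0]) auto
    with order_tendstoD(1)[OF cont1[of "{..<1}"] \<open>y < c * \<gamma>\<close>]
    have "\<forall>\<^sub>F b in at_left 1. c * b powr \<rho> * \<gamma> > y \<and> b \<in> {0<..<1}" by eventually_elim simp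
    then obtain b where b: "b > 0" "b < 1" "c * b powr \<rho> * \<gamma> > y"
      using eventually_happens[of _ "at_left (1::real)"] by auto
    obtain err where err: "err \<longlonglongrightarrow> 0" "\<And>n. n > 0 \<Longrightarrow> (\<Sum>k\<le>nat \<lfloor>b * real n\<rfloor>. c * r k) / real n powr \<rho>
         \<le> err n + (\<Sum>k\<le>n. d k) / real n powr \<rho>"
      using cutoff[of b 1 "\<lambda>k. c * r k" d] b by auto
    have "(\<lambda>n. (\<Sum>k\<le>nat \<lfloor>b * real n\<rfloor>. c * r k) / real n powr \<rho> - err n) \<longlonglongrightarrow> c * b powr \<rho> * \<gamma> - 0"
      using b by (intro tendsto_diff err lim_ref) auto
    from order_tendstoD(1)[OF this, of y] b(3)
    have "\<forall>\<^sub>F n in sequentially. (\<Sum>k\<le>nat \<lfloor>b * real n\<rfloor>. c * r k) / real n powr \<rho> - err n > y" by simp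
    with eventually_gt_at_top[of 0] show "\<forall>\<^sub>F n in sequentially. (\<Sum>k\<le>n. d k) / real n powr \<rho> > y"
    proof eventually_elim
      case (elim n)
      thus ?case using err(2)[of n] by linarith
    qed
  qed
  thus ?thesis by (simp add: \<gamma>_def)
qed

section \<open>Riemann sums of the hyperbolic secant\<close>

text \<open>
  Up to a constant, this primitive is the Gudermannian function.
\<close>

lemma DERIV_two_arctan_exp:
  "((\<lambda>x. 2 * arctan (exp x)) has_real_derivative 1 / cosh x) (at x)" for x :: real
proof -
  have "((\<lambda>x. 2 * arctan (exp x)) has_real_derivative 2 * (inverse (1 + (exp x)\<^sup>2) * exp x)) (at x)"
    by (auto intro!: derivative_eq_intros)
  moreover have "2 * (inverse (1 + (exp x)\<^sup>2) * exp x) = 1 / cosh x"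
  proof -
    have "exp x * exp (- x) = 1" by (simp add: exp_minus)
    hence "1 + (exp x)\<^sup>2 = exp x * (2 * cosh x)"
      by (simp add: cosh_field_def power2_eq_square algebra_simps)
    thus ?thesis by (simp add: field_simps)
  qed
  ultimately show ?thesis by simp
qed

lemma sech_integral_bounds:
  fixes a b :: real
  assumes "0 \<le> a" "a < b"
  shows "(b - a) / cosh b \<le> 2 * arctan (exp b) - 2 * arctan (exp a)"
    and "2 * arctan (exp b) - 2 * arctan (exp a) \<le> (b - a) / cosh a"
proof -
  obtain z where z: "a < z" "z < b" "2 * arctan (exp b) - 2 * arctan (exp a) = (b - a) * (1 / cosh z)"
    using MVT2[OF assms(2), of "\<lambda>x. 2 * arctan (exp x)" "\<lambda>x. 1 / cosh x"] DERIV_two_arctan_exp by blast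
  have "cosh a \<le> cosh z" "cosh z \<le> cosh b" using z assms by (auto simp: cosh_real_nonneg_le_iff)
  thus "(b - a) / cosh b \<le> 2 * arctan (exp b) - 2 * arctan (exp a)"
    "2 * arctan (exp b) - 2 * arctan (exp a) \<le> (b - a) / cosh a"
    using z assms by (auto intro!: divide_left_mono)
qed

text \<open>
  Since \<open>1 / cosh\<close> decreases on the positive axis and has the primitive \<open>2 * arctan (exp x)\<close>,
  the sum times the mesh \<open>\<theta>\<close> is a one-sided Riemann sum of its integral over the half-line,
  which is \<open>\<pi> / 2\<close>.
\<close>

lemma sum_sech_upper:
  fixes \<theta> :: real
  assumes "\<theta> > 0"
  shows "\<theta> * (\<Sum>k=1..K. 1 / cosh (real k * \<theta>)) \<le> pi / 2"
proof -
  have "\<theta> * (\<Sum>k=1..K. 1 / cosh (real k * \<theta>)) \<le> 2 * arctan (exp (real K * \<theta>)) - 2 * arctan (exp 0)"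
  proof (induction K)
    case (Suc K)
    show ?case using Suc sech_integral_bounds(1)[of "real K * \<theta>" "real (Suc K) * \<theta>"] assms
      by (simp add: algebra_simps)
  qed simp
  also have "\<dots> \<le> pi / 2" using arctan_ubound[of "exp (real K * \<theta>)"] by (simp add: arctan_one)
  finally show ?thesis .
qed

lemma sum_sech_lower:
  fixes \<theta> :: real
  assumes "\<theta> > 0"
  shows "2 * arctan (exp (real (Suc K) * \<theta>)) - 2 * arctan (exp \<theta>) \<le> \<theta> * (\<Sum>k=1..K. 1 / cosh (real k * \<theta>))"
proof (induction K)
  case (Suc K)
  show ?case using Suc sech_integral_bounds(2)[of "real (Suc K) * \<theta>" "real (Suc (Suc K)) * \<theta>"] assms
    by (simp add: algebra_simps)
qed simp

section \<open>The decay exponents of the comb\<close>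

text \<open>
  The solution \<open>\<theta>\<close> of \<open>cosh \<theta> = (1 + sqrt (1 - z\<^sup>2)) / z\<close>: then \<open>cosh (\<theta> x)\<close> describes the
  dependence on \<open>x\<close> of the eigenfunction of the walk with eigenvalue \<open>1 / z\<close>.
\<close>

definition comb_angle :: "real \<Rightarrow> real" where
  "comb_angle z = arcosh ((1 + sqrt (1 - z\<^sup>2)) / z)"

lemma cosh_comb_angle:
  assumes "0 < z" "z < 1"
  shows "cosh (comb_angle z) = (1 + sqrt (1 - z\<^sup>2)) / z" "comb_angle z > 0"
proof -
  have "z\<^sup>2 < 1" using assms by (simp add: power_less_one_iff)
  hence "1 + sqrt (1 - z\<^sup>2) > z" using assms by (smt (verit) real_sqrt_gt_zero)
  hence *: "(1 + sqrt (1 - z\<^sup>2)) / z > 1" using assms by (simp add: field_simps)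
  thus "cosh (comb_angle z) = (1 + sqrt (1 - z\<^sup>2)) / z" unfolding comb_angle_def
    by (intro cosh_arcosh_real) simp
  show "comb_angle z > 0" unfolding comb_angle_def using * arcosh_real_gt_1_iff by (metis less_imp_le less_irrefl)
qed

text \<open>
  As \<open>t\<close> tends to 0, \<open>\<theta>\<^sup>2 / 2\<close> is asymptotic to \<open>sqrt (1 - z\<^sup>2)\<close>, hence to \<open>sqrt (2 t)\<close>.  This is the origin of
  the exponent \<open>1 / 4\<close>.
\<close>

lemma comb_angle_asymp:
  "((\<lambda>t. t powr (1/4) / comb_angle (exp (- t))) \<longlongrightarrow> 2 powr (-3/4)) (at_right 0)"
  proof -
  have "inverse ((2 powr (1/2) * 2) powr (1/2)) = (2::real) powr (-3/4)"
  proof -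
    have "(2::real) powr (1/2) * 2 = 2 powr (3/2)" using powr_add[of "2::real" "1/2" 1] by simp
    thus ?thesis by (simp add: powr_powr powr_minus)
  qed
  moreover have "((\<lambda>t. t powr (1/4) / comb_angle (exp (- t))) \<longlongrightarrow> inverse ((2 powr (1/2) * 2) powr (1/2))) (at_right 0)"
    unfolding comb_angle_def arcosh_real_def by real_asymp
  ultimately show ?thesis by simp
qed

lemma comb_angle_tendsto_0:
  "((\<lambda>t. comb_angle (exp (- t))) \<longlongrightarrow> 0) (at_right 0)"
  unfolding comb_angle_def arcosh_real_def by real_asymp

section \<open>The law of the history of a random walk\<close>

text \<open>
  Histories are listed backwards, so that the head is the current vertex.  Keeping the whole
  history makes both the walk and its maximum functions of a single discrete random variable.
\<close>

primrec history_pmf :: "('v \<Rightarrow> 'v \<Rightarrow> bool) \<Rightarrow> 'v \<Rightarrow> nat \<Rightarrow> 'v list pmf" where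
  "history_pmf E v\<^sub>0 0 = return_pmf [v\<^sub>0]"
| "history_pmf E v\<^sub>0 (Suc n) = history_pmf E v\<^sub>0 n \<bind> (\<lambda>l. map_pmf (\<lambda>v. v # l) (pmf_of_set {v. E (hd l) v}))"

lemma length_history_pmf: "l \<in> set_pmf (history_pmf E v\<^sub>0 n) \<Longrightarrow> length l = Suc n"
  by (induction n arbitrary: l) auto

lemma pmf_history_Suc:
  "pmf (history_pmf E v\<^sub>0 (Suc n)) (v # l) = pmf (history_pmf E v\<^sub>0 n) l * pmf (pmf_of_set {v. E (hd l) v}) v"
proof -
  have "pmf (map_pmf (\<lambda>v. v # x) (pmf_of_set {v. E (hd x) v})) (v # l) =
      indicator {l} x * pmf (pmf_of_set {v. E (hd l) v}) v" for x
  proof (cases "x = l")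
    case True
    thus ?thesis using pmf_map_inj'[of "\<lambda>v. v # l" "pmf_of_set {v. E (hd l) v}" v] by (simp add: inj_on_def)
  next
    case False
    hence "v # l \<notin> set_pmf (map_pmf (\<lambda>v. v # x) (pmf_of_set {v. E (hd x) v}))" by auto
    thus ?thesis using False by (simp only: pmf_eq_0_set_pmf[symmetric]) simp
  qed
  thus ?thesis by (simp add: pmf_bind measure_pmf_single)
qed

definition history :: "(nat \<Rightarrow> 'w \<Rightarrow> 'v) \<Rightarrow> nat \<Rightarrow> 'w \<Rightarrow> 'v list" where
  "history S n \<omega> = rev (map (\<lambda>i. S i \<omega>) [0..<Suc n])"

lemma history_simps:
  "history S 0 \<omega> = [S 0 \<omega>]" "history S (Suc n) \<omega> = S (Suc n) \<omega> # history S n \<omega>"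
  by (simp_all add: history_def)

lemma set_history: "set (history S n \<omega>) = (\<lambda>i. S i \<omega>) ` {..n}"
  by (simp add: history_def atLeast0LessThan lessThan_Suc_atMost del: upt_Suc)

lemma history_eq_iff:
  assumes "length l = Suc n"
  shows "history S n \<omega> = l \<longleftrightarrow> (\<forall>i\<le>n. S i \<omega> = rev l ! i)"
proof -
  have "history S n \<omega> = l \<longleftrightarrow> map (\<lambda>i. S i \<omega>) [0..<Suc n] = rev l"
    unfolding history_def by (metis rev_rev_ident)
  also have "\<dots> \<longleftrightarrow> (\<forall>i\<le>n. S i \<omega> = rev l ! i)"
    using assms by (subst list_eq_iff_nth_eq) (auto simp: less_Suc_eq_le nth_append simp del: upt_Suc)
  finally show ?thesis .
qed

context simple_random_walk
begin

lemma prob_history: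
  "prob {\<omega>\<in>space M. history S n \<omega> = l} = pmf (history_pmf E v\<^sub>0 n) l"
proof (induction n arbitrary: l)
  case 0
  show ?case
  proof (cases "l = [v\<^sub>0]")
    case True
    have "AE \<omega> in M. history S 0 \<omega> = l" using walk_start by eventually_elim (simp add: history_simps True)
    hence "prob {\<omega>\<in>space M. history S 0 \<omega> = l} = 1"
      using walk_measurable[of 0] by (subst prob_Collect_eq_1) (auto simp: history_simps True)
    thus ?thesis by (simp add: True)
  next
    case False
    have "AE \<omega> in M. \<not> history S 0 \<omega> = l" using walk_start by eventually_elim (use False in \<open>simp add: history_simps\<close>)
    hence "prob {\<omega>\<in>space M. history S 0 \<omega> = l} = 0"
      using AE_iff_measurable[of "{\<omega>\<in>space M. history S 0 \<omega> = l}" M "\<lambda>\<omega>. \<not> history S 0 \<omega> = l"]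
        measure_notin_sets[of "{\<omega>\<in>space M. history S 0 \<omega> = l}" M]
      by (cases "{\<omega>\<in>space M. history S 0 \<omega> = l} \<in> sets M") (auto simp: measure_def)
    thus ?thesis using False by (simp add: pmf_return)
  qed
next
  case (Suc n)
  show ?case
  proof (cases "length l = Suc (Suc n)")
    case False
    hence "{\<omega>\<in>space M. history S (Suc n) \<omega> = l} = {}" by (auto simp: history_def simp del: upt_Suc)
    moreover have "l \<notin> set_pmf (history_pmf E v\<^sub>0 (Suc n))" using length_history_pmf[of l E v\<^sub>0 "Suc n"] False by auto
    ultimately show ?thesis by (metis measure_empty pmf_eq_0_set_pmf)
  next
    case True
    then obtain v l' where l: "l = v # l'" "length l' = Suc n" by (cases l) auto
    define p where "p = nth (rev l')"
    have "l' \<noteq> []" using l(2) by auto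
    hence pn: "p n = hd l'" using l(2) by (simp add: p_def rev_nth hd_conv_nth)
    have hist: "history S n \<omega> = l' \<longleftrightarrow> (\<forall>i\<le>n. S i \<omega> = p i)" for \<omega>
      using history_eq_iff[OF l(2)] by (simp add: p_def)
    have "prob {\<omega>\<in>space M. history S (Suc n) \<omega> = l} = \<P>(\<omega> in M. S (Suc n) \<omega> = v \<and> (\<forall>i\<le>n. S i \<omega> = p i))"
      by (simp add: history_simps l hist)
    also have "\<dots> = \<P>(\<omega> in M. \<forall>i\<le>n. S i \<omega> = p i) * pmf (pmf_of_set {v. E (p n) v}) v"
    proof (cases "\<P>(\<omega> in M. \<forall>i\<le>n. S i \<omega> = p i) > 0")
      case True
      note walk_step[OF this, of v, symmetric]
      thus ?thesis using True by (simp only: cond_prob_def) simp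
    next
      \<comment> \<open>Histories of probability zero, where no conditional law is given, have extensions of probability zero.\<close>
      case False
      hence z: "\<P>(\<omega> in M. \<forall>i\<le>n. S i \<omega> = p i) = 0"
        using measure_nonneg[of M "{\<omega>\<in>space M. \<forall>i\<le>n. S i \<omega> = p i}"] by linarith
      have S_sets: "{\<omega>\<in>space M. S i \<omega> = p i} \<in> sets M" for i
        using walk_measurable[of i] by (rule measurable_sets_Collect) simp
      have "\<P>(\<omega> in M. S (Suc n) \<omega> = v \<and> (\<forall>i\<le>n. S i \<omega> = p i)) \<le> \<P>(\<omega> in M. \<forall>i\<le>n. S i \<omega> = p i)"
        using S_sets by (intro finite_measure_mono sets.sets_Collect_finite_All') auto
      hence "\<P>(\<omega> in M. S (Suc n) \<omega> = v \<and> (\<forall>i\<le>n. S i \<omega> = p i)) = 0"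
        unfolding z using measure_nonneg by (rule antisym)
      thus ?thesis unfolding z by simp
    qed
    also have "\<dots> = pmf (history_pmf E v\<^sub>0 n) l' * pmf (pmf_of_set {v. E (hd l') v}) v"
      unfolding Suc.IH[symmetric] hist pn ..
    finally show ?thesis using l by (simp only: pmf_history_Suc)
  qed
qed

end

text \<open>
  The hypotheses on the walk determine the law of its history up to time \<open>n\<close>, so every
  expectation that depends on finitely many steps can be computed in \<open>history_pmf\<close>, where
  everything is a finite sum.
\<close>

lemma expectation_history:
  fixes S :: "nat \<Rightarrow> 'w \<Rightarrow> 'v :: countable" and \<phi> :: "'v list \<Rightarrow> real"
  assumes "simple_random_walk M E v\<^sub>0 S"
  shows "(\<integral>\<omega>. \<phi> (history S n \<omega>) \<partial>M) = measure_pmf.expectation (history_pmf E v\<^sub>0 n) \<phi>"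
proof -
  interpret simple_random_walk M E v\<^sub>0 S by fact
  have meas: "history S n \<in> M \<rightarrow>\<^sub>M count_space UNIV"
  proof (induction n)
    case 0
    show ?case unfolding history_simps[abs_def] using walk_measurable by measurable
  next
    case (Suc n)
    show ?case unfolding history_simps[abs_def] using walk_measurable Suc by measurable
  qed
  have "distr M (count_space UNIV) (history S n) = measure_pmf (history_pmf E v\<^sub>0 n)"
  proof (rule measure_eqI_countable[of _ UNIV])
    fix l
    have "emeasure (distr M (count_space UNIV) (history S n)) {l} = emeasure M {\<omega>\<in>space M. history S n \<omega> = l}"
      using meas by (subst emeasure_distr) (auto intro!: arg_cong[where f = "emeasure M"])
    also have "\<dots> = emeasure (measure_pmf (history_pmf E v\<^sub>0 n)) {l}"
      by (simp add: emeasure_eq_measure prob_history emeasure_pmf_single)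
    finally show "emeasure (distr M (count_space UNIV) (history S n)) {l}
        = emeasure (measure_pmf (history_pmf E v\<^sub>0 n)) {l}" .
  qed auto
  thus ?thesis using integral_distr[OF meas, of \<phi>] by simp
qed

section \<open>The maximal horizontal displacement on the comb\<close>

definition max_abs_fst :: "(int \<times> int) list \<Rightarrow> int" where
  "max_abs_fst l = Max ((\<lambda>v. \<bar>fst v\<bar>) ` set l)"

lemma max_horizontal_history: "max_horizontal S n \<omega> = max_abs_fst (history S n \<omega>)"
proof -
  have "{\<bar>fst (S i \<omega>)\<bar> |i. i \<le> n} = (\<lambda>v. \<bar>fst v\<bar>) ` set (history S n \<omega>)"
    unfolding set_history by auto
  thus ?thesis by (simp add: max_horizontal_def max_abs_fst_def)
qed

abbreviation comb_history :: "nat \<Rightarrow> (int \<times> int) list pmf" where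
  "comb_history \<equiv> history_pmf comb_adj (0, 0)"

definition confined :: "nat \<Rightarrow> (int \<times> int) list \<Rightarrow> bool" where
  "confined k l \<longleftrightarrow> (\<forall>v\<in>set l. \<bar>fst v\<bar> < int k)"

lemma set_comb_step: "set_pmf (pmf_of_set {v. comb_adj u v}) = {v. comb_adj u v}"
  by (rule set_pmf_of_set[OF comb_neighbours_nonempty comb_neighbours_finite])

lemma finite_comb_history: "finite (set_pmf (comb_history n))"
  by (induction n) (simp_all add: set_comb_step comb_neighbours_finite)

lemma expectation_comb_history_Suc:
  fixes \<phi> :: "(int \<times> int) list \<Rightarrow> real"
  shows "measure_pmf.expectation (comb_history (Suc n)) \<phi> =
    measure_pmf.expectation (comb_history n) (\<lambda>l. (\<Sum>v | comb_adj (hd l) v. \<phi> (v # l)) / card {v. comb_adj (hd l) v})"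
proof -
  have "measure_pmf.expectation (comb_history (Suc n)) \<phi> =
     (\<Sum>l\<in>set_pmf (comb_history n). pmf (comb_history n) l *\<^sub>R
        measure_pmf.expectation (map_pmf (\<lambda>v. v # l) (pmf_of_set {v. comb_adj (hd l) v})) \<phi>)"
    by (simp only: history_pmf.simps, rule pmf_expectation_bind)
       (simp_all add: finite_comb_history comb_neighbours_finite set_comb_step)
  also have "\<dots> = (\<Sum>l\<in>set_pmf (comb_history n). pmf (comb_history n) l *\<^sub>R
     ((\<Sum>v | comb_adj (hd l) v. \<phi> (v # l)) / card {v. comb_adj (hd l) v}))"
    by (simp only: integral_map_pmf integral_pmf_of_set[OF comb_neighbours_nonempty comb_neighbours_finite])
  also have "\<dots> = measure_pmf.expectation (comb_history n) (\<lambda>l. (\<Sum>v | comb_adj (hd l) v. \<phi> (v # l)) / card {v. comb_adj (hd l) v})"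
    by (rule integral_measure_pmf[symmetric]) (auto simp: finite_comb_history)
  finally show ?thesis .
qed

lemma comb_history_bound:
  "l \<in> set_pmf (comb_history n) \<Longrightarrow> \<forall>v\<in>set l. \<bar>fst v\<bar> \<le> int n"
proof (induction n arbitrary: l)
  case (Suc n)
  then obtain v l' where l: "l = v # l'" "l' \<in> set_pmf (comb_history n)" "comb_adj (hd l') v"
    by (auto simp: set_comb_step)
  have "l' \<noteq> []" using length_history_pmf[OF l(2)] by auto
  hence "\<bar>fst (hd l')\<bar> \<le> int n" using Suc.IH[OF l(2)] by simp
  moreover have "\<bar>fst v\<bar> \<le> \<bar>fst (hd l')\<bar> + 1" using l(3) by (cases v; cases "hd l'") auto
  ultimately show ?case using Suc.IH[OF l(2)] l(1) by force
qed simp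

text \<open>
  A tail sum: the maximum is the number of levels \<open>k \<ge> 1\<close> that it reaches.
\<close>

lemma max_abs_fst_eq_sum:
  assumes "l \<noteq> []" "\<forall>v\<in>set l. \<bar>fst v\<bar> \<le> int K"
  shows "real_of_int (max_abs_fst l) = (\<Sum>k=1..K. 1 - of_bool (confined k l))"
proof -
  have ne: "finite ((\<lambda>v. \<bar>fst v\<bar>) ` set l)" "(\<lambda>v. \<bar>fst v\<bar>) ` set l \<noteq> {}" using assms(1) by auto
  have le: "max_abs_fst l \<le> int K" unfolding max_abs_fst_def using assms(2) by (subst Max_le_iff[OF ne]) simp
  have nn: "max_abs_fst l \<ge> 0" unfolding max_abs_fst_def using assms(1) by (subst Max_ge_iff[OF ne]) (cases l, auto)
  have iff: "confined k l \<longleftrightarrow> max_abs_fst l < int k" for k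
    unfolding confined_def max_abs_fst_def by (subst Max_less_iff[OF ne]) simp
  have "(\<Sum>k=1..K. 1 - of_bool (confined k l)) = (\<Sum>k\<in>{1..K}. if k \<in> {1..nat (max_abs_fst l)} then 1 else (0::real))"
    by (intro sum.cong refl) (auto simp: iff)
  also have "\<dots> = (\<Sum>k\<in>{1..K} \<inter> {1..nat (max_abs_fst l)}. 1)"
    by (rule sum.inter_restrict[symmetric]) simp
  also have "{1..K} \<inter> {1..nat (max_abs_fst l)} = {1..nat (max_abs_fst l)}" using le by auto
  finally show ?thesis using nn by simp
qed

definition confinement_prob :: "nat \<Rightarrow> nat \<Rightarrow> real" where
  "confinement_prob k n = measure_pmf.expectation (comb_history n) (\<lambda>l. of_bool (confined k l))"

definition mean_max_abs_fst :: "nat \<Rightarrow> real" where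
  "mean_max_abs_fst n = measure_pmf.expectation (comb_history n) (\<lambda>l. real_of_int (max_abs_fst l))"

lemma integrable_comb_history [simp]:
  "integrable (measure_pmf (comb_history n)) (\<phi> :: _ \<Rightarrow> real)"
  by (rule integrable_measure_pmf_finite) (rule finite_comb_history)

lemma mean_max_abs_fst_eq:
  assumes "n \<le> K"
  shows "mean_max_abs_fst n = (\<Sum>k=1..K. 1 - confinement_prob k n)"
proof -
  have "mean_max_abs_fst n = measure_pmf.expectation (comb_history n) (\<lambda>l. \<Sum>k=1..K. 1 - of_bool (confined k l))"
    unfolding mean_max_abs_fst_def
  proof (intro integral_cong_AE AE_pmfI)
    fix l assume l: "l \<in> set_pmf (comb_history n)"
    have "l \<noteq> []" using length_history_pmf[OF l] by auto
    moreover have "\<forall>v\<in>set l. \<bar>fst v\<bar> \<le> int K" using comb_history_bound[OF l] assms by force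
    ultimately show "real_of_int (max_abs_fst l) = (\<Sum>k=1..K. 1 - of_bool (confined k l))"
      by (rule max_abs_fst_eq_sum)
  qed simp_all
  also have "\<dots> = (\<Sum>k=1..K. 1 - confinement_prob k n)"
    by (simp add: confinement_prob_def measure_pmf.prob_space)
  finally show ?thesis .
qed

lemma confinement_prob_antimono: "confinement_prob k (Suc n) \<le> confinement_prob k n"
proof -
  have "confinement_prob k (Suc n) = measure_pmf.expectation (comb_history n)
      (\<lambda>l. (\<Sum>v | comb_adj (hd l) v. of_bool (confined k (v # l))) / card {v. comb_adj (hd l) v})"
    unfolding confinement_prob_def by (rule expectation_comb_history_Suc)
  also have "\<dots> \<le> measure_pmf.expectation (comb_history n) (\<lambda>l. of_bool (confined k l))"
  proof (rule integral_mono)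
    fix l
    have "(\<Sum>v | comb_adj (hd l) v. of_bool (confined k (v # l))) \<le> (\<Sum>v | comb_adj (hd l) v. (of_bool (confined k l) :: real))"
      by (intro sum_mono) (auto simp: confined_def)
    thus "(\<Sum>v | comb_adj (hd l) v. of_bool (confined k (v # l))) / card {v. comb_adj (hd l) v} \<le> (of_bool (confined k l) :: real)"
      using comb_neighbours_nonempty[of "hd l"] comb_neighbours_finite[of "hd l"]
      by (simp add: divide_simps card_gt_0_iff mult.commute)
  qed simp_all
  finally show ?thesis by (simp add: confinement_prob_def)
qed

section \<open>The generating function of the exit time from a strip\<close>

text \<open>
  The generating function of the hitting time of 0 for the simple random walk on the integers
  started at 1, that is, of the time to come down a tooth by one step.
\<close>

definition comb_decay :: "real \<Rightarrow> real" where
  "comb_decay z = (1 - sqrt (1 - z\<^sup>2)) / z"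

definition comb_eigen :: "real \<Rightarrow> int \<times> int \<Rightarrow> real" where
  "comb_eigen z v = cosh (real_of_int (fst v) * comb_angle z) * comb_decay z ^ nat \<bar>snd v\<bar>"

lemma comb_decay_bounds:
  assumes "0 < z" "z < 1"
  shows "comb_decay z > 0" "comb_decay z \<le> 1" "z * ((comb_decay z)\<^sup>2 + 1) = 2 * comb_decay z"
proof -
  have z2: "0 < z\<^sup>2" "z\<^sup>2 < 1" using assms by (simp_all add: power_less_one_iff)
  define s where "s = sqrt (1 - z\<^sup>2)"
  have s: "s > 0" "s < 1" "s\<^sup>2 = 1 - z\<^sup>2" using z2 by (auto simp: s_def)
  show "comb_decay z > 0" using s assms by (simp add: comb_decay_def flip: s_def)
  have "(1 - s) \<le> z"
  proof (rule ccontr)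
    assume "\<not> 1 - s \<le> z"
    hence "(1 - s)\<^sup>2 > z\<^sup>2" using assms by (intro power_strict_mono) auto
    hence "2 * s * s > 2 * s" using s(3) by (simp add: power2_eq_square algebra_simps)
    thus False using s by simp
  qed
  thus "comb_decay z \<le> 1" using assms by (simp add: comb_decay_def flip: s_def)
  show "z * ((comb_decay z)\<^sup>2 + 1) = 2 * comb_decay z" using assms s(3)
    by (simp add: comb_decay_def power_divide flip: s_def)
       (simp add: field_simps power2_eq_square)
qed

text \<open>
  On a tooth this is the quadratic equation for \<open>comb_decay z\<close>; on the backbone it is the
  addition theorem for \<open>cosh\<close>, and \<open>comb_angle z\<close> is chosen for it to hold.
\<close>

lemma comb_eigen_harmonic:
  assumes "0 < z" "z < 1"
  shows "z * ((\<Sum>v | comb_adj u v. comb_eigen z v) / card {v. comb_adj u v}) = comb_eigen z u"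
proof -
  obtain x y where u: "u = (x, y)" by force
  define \<alpha> where "\<alpha> = comb_decay z"
  have \<alpha>: "z * (\<alpha>\<^sup>2 + 1) = 2 * \<alpha>" using comb_decay_bounds(3)[OF assms] by (simp add: \<alpha>_def)
  let ?c = "\<lambda>x. cosh (real_of_int x * comb_angle z)"
  show ?thesis
  proof (cases "y = 0")
    case True
    have shift: "?c (x + 1) + ?c (x - 1) = 2 * ?c x * cosh (comb_angle z)"
      by (simp add: distrib_right left_diff_distrib cosh_add cosh_diff)
    have four: "z * (2 * cosh (comb_angle z) + 2 * \<alpha>) = 4"
      using assms by (simp add: cosh_comb_angle \<alpha>_def comb_decay_def field_simps)
    have "(\<Sum>v | comb_adj u v. comb_eigen z v) = 2 * (?c x * \<alpha>) + (?c (x + 1) + ?c (x - 1))"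
      by (simp add: u comb_neighbours True comb_eigen_def \<alpha>_def)
    hence "(\<Sum>v | comb_adj u v. comb_eigen z v) = ?c x * (2 * cosh (comb_angle z) + 2 * \<alpha>)"
      unfolding shift by (simp only: distrib_left mult_ac add_ac)
    hence "z * (\<Sum>v | comb_adj u v. comb_eigen z v) = ?c x * (z * (2 * cosh (comb_angle z) + 2 * \<alpha>))"
      by (simp only: mult.left_commute)
    also have "\<dots> = 4 * ?c x" unfolding four by simp
    finally have "z * (\<Sum>v | comb_adj u v. comb_eigen z v) = 4 * ?c x" .
    thus ?thesis by (simp add: u comb_degree True comb_eigen_def)
  next
    case False
    hence "nat \<bar>y\<bar> \<noteq> 0" by simp
    then obtain m where m: "nat \<bar>y\<bar> = Suc m" using not0_implies_Suc by blast
    have "\<alpha> ^ nat \<bar>y + 1\<bar> + \<alpha> ^ nat \<bar>y - 1\<bar> = \<alpha> ^ (Suc (Suc m)) + \<alpha> ^ m"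
    proof (cases "y > 0")
      case True
      hence "nat \<bar>y + 1\<bar> = Suc (Suc m)" "nat \<bar>y - 1\<bar> = m" using m by auto
      thus ?thesis by (simp only:)
    next
      case F: False
      hence "nat \<bar>y - 1\<bar> = Suc (Suc m)" "nat \<bar>y + 1\<bar> = m" using m False by auto
      thus ?thesis by (simp only: add.commute)
    qed
    also have "\<dots> = \<alpha> ^ m * (\<alpha>\<^sup>2 + 1)" by (simp add: power2_eq_square algebra_simps)
    finally have "z * (\<alpha> ^ nat \<bar>y + 1\<bar> + \<alpha> ^ nat \<bar>y - 1\<bar>) = 2 * \<alpha> ^ nat \<bar>y\<bar>"
      using \<alpha> m by (simp add: mult.left_commute)
    moreover have "(\<Sum>v | comb_adj u v. comb_eigen z v) = ?c x * (\<alpha> ^ nat \<bar>y + 1\<bar> + \<alpha> ^ nat \<bar>y - 1\<bar>)"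
      using False by (simp add: u comb_neighbours comb_eigen_def \<alpha>_def distrib_left)
    ultimately have "z * (\<Sum>v | comb_adj u v. comb_eigen z v) = 2 * (?c x * \<alpha> ^ nat \<bar>y\<bar>)"
      by (simp add: mult.left_commute)
    thus ?thesis using False by (simp add: u comb_degree comb_eigen_def \<alpha>_def)
  qed
qed


definition confined_mean :: "real \<Rightarrow> nat \<Rightarrow> nat \<Rightarrow> real" where
  "confined_mean z k n = measure_pmf.expectation (comb_history n)
     (\<lambda>l. of_bool (confined k l) * comb_eigen z (hd l))"

text \<open>
  One step of the martingale \<open>z ^ n * comb_eigen z (S n)\<close> stopped on leaving the strip
  \<open>\<bar>x\<bar> < k\<close>.  The walk can leave the strip only along the backbone, so it exits at a point
  \<open>(k, 0)\<close> or \<open>(- k, 0)\<close>, where \<open>comb_eigen\<close> has the same value \<open>cosh (k \<theta>)\<close>.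
\<close>

lemma confined_mean_step:
  assumes z: "0 < z" "z < 1"
  shows "confined_mean z k n = z * (confined_mean z k (Suc n)
           + cosh (real k * comb_angle z) * (confinement_prob k n - confinement_prob k (Suc n)))"
proof -
  define C where "C = cosh (real k * comb_angle z)"
  let ?N = "\<lambda>l. {v. comb_adj (hd l) v}"
  let ?g = "\<lambda>l. of_bool (confined k l) * comb_eigen z (hd l)"
  let ?E = "\<lambda>n. measure_pmf.expectation (comb_history n)"
  \<comment> \<open>Every successor \<open>v\<close> of a confined history contributes \<open>comb_eigen z v - C\<close>: if it leaves the
    strip, then \<open>comb_eigen z v = C\<close>.\<close>
  have pt: "z * ((\<Sum>v\<in>?N l. ?g (v # l) - C * of_bool (confined k (v # l))) / card (?N l)
        + C * of_bool (confined k l)) = ?g l" if l: "l \<noteq> []" for l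
  proof (cases "confined k l")
    case True
    have card: "card (?N l) > 0" using comb_neighbours_nonempty comb_neighbours_finite by (simp add: card_gt_0_iff)
    have "?g (v # l) - C * of_bool (confined k (v # l)) = comb_eigen z v - C" if v: "v \<in> ?N l" for v
    proof (cases "confined k (v # l)")
      case F: False
      hence ge: "\<bar>fst v\<bar> \<ge> int k" using True by (auto simp: confined_def)
      have lt: "\<bar>fst (hd l)\<bar> < int k" using True l by (simp add: confined_def)
      obtain x y where hd: "hd l = (x, y)" by force
      obtain x' y' where v': "v = (x', y')" by force
      have "y' = 0 \<and> \<bar>x'\<bar> = int k" using v ge lt by (auto simp: hd v')
      hence "y' = 0" "x' = int k \<or> x' = - int k" by auto
      hence "comb_eigen z v = C" by (auto simp: comb_eigen_def v' C_def)
      thus ?thesis using F by simp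
    qed simp
    hence "(\<Sum>v\<in>?N l. ?g (v # l) - C * of_bool (confined k (v # l))) = (\<Sum>v\<in>?N l. comb_eigen z v) - card (?N l) * C"
      by (simp add: sum_subtractf)
    hence "(\<Sum>v\<in>?N l. ?g (v # l) - C * of_bool (confined k (v # l))) / card (?N l) + C * of_bool (confined k l)
       = (\<Sum>v\<in>?N l. comb_eigen z v) / card (?N l)"
      using card True by (simp add: diff_divide_distrib)
    thus ?thesis using comb_eigen_harmonic[OF z, of "hd l"] True by simp
  next
    case False
    hence "\<not> confined k (v # l)" for v by (auto simp: confined_def)
    thus ?thesis using False by simp
  qed
  have "confined_mean z k (Suc n) - C * confinement_prob k (Suc n) =
      ?E (Suc n) (\<lambda>l. ?g l - C * of_bool (confined k l))"
    unfolding confined_mean_def confinement_prob_def by (simp del: history_pmf.simps)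
  also have "\<dots> = ?E n (\<lambda>l. (\<Sum>v\<in>?N l. ?g (v # l) - C * of_bool (confined k (v # l))) / card (?N l))"
    by (rule expectation_comb_history_Suc)
  finally have "z * (confined_mean z k (Suc n) - C * confinement_prob k (Suc n) + C * confinement_prob k n)
     = ?E n (\<lambda>l. z * ((\<Sum>v\<in>?N l. ?g (v # l) - C * of_bool (confined k (v # l))) / card (?N l)
        + C * of_bool (confined k l)))"
    by (simp add: confinement_prob_def del: history_pmf.simps)
  also have "\<dots> = ?E n ?g"
    by (intro integral_cong_AE AE_pmfI pt) (auto dest: length_history_pmf)
  finally show ?thesis by (simp add: confined_mean_def C_def algebra_simps)
qed

text \<open>
  Optional stopping: the summand is \<open>z ^ Suc n\<close> times the probability that the strip \<open>\<bar>x\<bar> < k\<close> is left at time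
  \<open>Suc n\<close>.  Inside the strip \<open>comb_eigen\<close> is at most \<open>cosh (k \<theta>)\<close>, so the part of the martingale that
  has not yet been stopped vanishes in the limit.
\<close>

lemma exit_time_gf:
  assumes z: "0 < z" "z < 1" and "k > 0"
  shows "(\<lambda>n. (confinement_prob k n - confinement_prob k (Suc n)) * z ^ Suc n) sums (1 / cosh (real k * comb_angle z))"
proof -
  define C where "C = cosh (real k * comb_angle z)"
  have C: "C > 0" by (simp add: C_def)
  have bounds: "0 \<le> confined_mean z k n" "confined_mean z k n \<le> C" for n
  proof -
    have eg: "0 \<le> of_bool (confined k l) * comb_eigen z (hd l)" for l
      using comb_decay_bounds(1)[OF z] by (simp add: comb_eigen_def)
    thus "0 \<le> confined_mean z k n" unfolding confined_mean_def by (intro Bochner_Integration.integral_nonneg)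
    have le: "of_bool (confined k l) * comb_eigen z (hd l) \<le> C" if l: "l \<in> set_pmf (comb_history n)" for l
    proof (cases "confined k l")
      case True
      have "l \<noteq> []" using length_history_pmf[OF l] by auto
      hence "\<bar>fst (hd l)\<bar> < int k" using True by (simp add: confined_def)
      hence "\<bar>real_of_int (fst (hd l))\<bar> \<le> real k" by linarith
      hence "\<bar>real_of_int (fst (hd l)) * comb_angle z\<bar> \<le> real k * comb_angle z"
        using cosh_comb_angle(2)[OF z] by (simp add: abs_mult mult_right_mono)
      hence "cosh \<bar>real_of_int (fst (hd l)) * comb_angle z\<bar> \<le> C" unfolding C_def
        using cosh_comb_angle(2)[OF z] by (subst cosh_real_nonneg_le_iff) auto
      hence "comb_eigen z (hd l) \<le> C * 1" unfolding comb_eigen_def cosh_real_abs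
        using comb_decay_bounds[OF z] C by (intro mult_mono power_le_one) auto
      thus ?thesis using True by simp
    qed (use C in simp)
    have "confined_mean z k n \<le> measure_pmf.expectation (comb_history n) (\<lambda>l. C)"
      unfolding confined_mean_def by (intro integral_mono_AE AE_pmfI le) auto
    thus "confined_mean z k n \<le> C" by (simp add: measure_pmf.prob_space)
  qed
  have "(\<lambda>n. z ^ n * confined_mean z k n) \<longlonglongrightarrow> 0"
  proof (rule tendsto_sandwich[OF always_eventually always_eventually])
    show "\<forall>n. 0 \<le> z ^ n * confined_mean z k n" using bounds z by simp
    show "\<forall>n. z ^ n * confined_mean z k n \<le> z ^ n * C" using bounds z by (simp add: mult_left_mono)
    show "(\<lambda>n. z ^ n * C) \<longlonglongrightarrow> 0" using z by (intro tendsto_mult_left_zero LIMSEQ_realpow_zero) auto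
  qed auto
  from telescope_sums'[OF this]
  have "(\<lambda>n. z ^ n * confined_mean z k n - z ^ Suc n * confined_mean z k (Suc n)) sums confined_mean z k 0"
    by simp
  moreover have "confined_mean z k 0 = 1"
    using \<open>k > 0\<close> by (simp add: confined_mean_def confined_def comb_eigen_def)
  moreover have "z ^ n * confined_mean z k n - z ^ Suc n * confined_mean z k (Suc n)
      = C * ((confinement_prob k n - confinement_prob k (Suc n)) * z ^ Suc n)" for n
    by (subst confined_mean_step[OF z]) (simp add: C_def algebra_simps)
  ultimately have "(\<lambda>n. C * ((confinement_prob k n - confinement_prob k (Suc n)) * z ^ Suc n)) sums 1" by simp
  from sums_divide[OF this, of C] show ?thesis using C by (simp add: C_def)
qed

section \<open>Asymptotics of the expected maximum\<close>

text \<open>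
  Karamata's theorem gives the growth of the partial sums of a nonnegative sequence; the
  expected maxima are the partial sums of their increments.
\<close>

definition mean_increment :: "nat \<Rightarrow> real" where
  "mean_increment n = (case n of 0 \<Rightarrow> 0 | Suc m \<Rightarrow> mean_max_abs_fst (Suc m) - mean_max_abs_fst m)"

lemma mean_increment_eq:
  assumes "Suc n \<le> K"
  shows "mean_increment (Suc n) = (\<Sum>k=1..K. confinement_prob k n - confinement_prob k (Suc n))"
  using assms by (simp add: mean_increment_def mean_max_abs_fst_eq[of _ K] sum_subtractf)

lemma mean_increment_nonneg: "mean_increment n \<ge> 0"
proof (cases n)
  case (Suc m)
  show ?thesis unfolding Suc mean_increment_eq[OF order_refl]
    using confinement_prob_antimono by (intro sum_nonneg) simp
qed (simp add: mean_increment_def)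

lemma sum_mean_increment: "(\<Sum>i\<le>n. mean_increment i) = mean_max_abs_fst n"
proof (induction n)
  case 0
  have "mean_max_abs_fst 0 = 0" by (subst mean_max_abs_fst_eq[of 0 0]) auto
  thus ?case by (simp add: mean_increment_def)
qed (simp add: mean_increment_def)

lemma mean_increment_partial_gf:
  assumes "N \<le> K"
  shows "(\<Sum>n<Suc N. mean_increment n * z ^ n) =
     (\<Sum>k=1..K. \<Sum>n<N. (confinement_prob k n - confinement_prob k (Suc n)) * z ^ Suc n)"
proof -
  have "(\<Sum>n<Suc N. mean_increment n * z ^ n) = (\<Sum>n<N. mean_increment (Suc n) * z ^ Suc n)"
    by (subst sum.lessThan_Suc_shift) (simp add: mean_increment_def)
  also have "\<dots> = (\<Sum>n<N. \<Sum>k=1..K. (confinement_prob k n - confinement_prob k (Suc n)) * z ^ Suc n)"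
    using assms by (intro sum.cong refl) (simp only: mean_increment_eq[of _ K] sum_distrib_right lessThan_iff Suc_le_eq order_less_le_trans)
  also have "\<dots> = (\<Sum>k=1..K. \<Sum>n<N. (confinement_prob k n - confinement_prob k (Suc n)) * z ^ Suc n)"
    by (rule sum.swap)
  finally show ?thesis .
qed

text \<open>
  Summing the exit time generating functions over all levels \<open>k\<close> gives the generating function
  of the increments as the sum of \<open>1 / cosh (k \<theta>)\<close>, to which the Riemann sum bounds apply.
  Restricting to finitely many levels and times turns the interchange of summation into
  an upper and a lower bound.
\<close>

lemma mean_increment_gf_bounds:
  assumes z: "0 < z" "z < 1"
  shows "summable (\<lambda>n. mean_increment n * z ^ n)"
    and "comb_angle z * (\<Sum>n. mean_increment n * z ^ n) \<le> pi / 2"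
    and "comb_angle z * (\<Sum>n. mean_increment n * z ^ n) \<ge> pi - 2 * arctan (exp (comb_angle z))"
proof -
  let ?\<theta> = "comb_angle z"
  let ?p = "\<lambda>k n. (confinement_prob k n - confinement_prob k (Suc n)) * z ^ Suc n"
  have \<theta>: "?\<theta> > 0" by (rule cosh_comb_angle(2)[OF z])
  have pnn: "?p k n \<ge> 0" for k n using confinement_prob_antimono[of k n] z by simp
  have inn: "mean_increment n * z ^ n \<ge> 0" for n using mean_increment_nonneg[of n] z by simp
  have part: "(\<Sum>n<Suc N. mean_increment n * z ^ n) \<le> pi / 2 / ?\<theta>" for N
  proof -
    have "(\<Sum>n<Suc N. mean_increment n * z ^ n) = (\<Sum>k=1..N. \<Sum>n<N. ?p k n)"
      by (rule mean_increment_partial_gf) simp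
    also have "\<dots> \<le> (\<Sum>k=1..N. 1 / cosh (real k * ?\<theta>))"
    proof (rule sum_mono)
      fix k assume "k \<in> {1..N}"
      hence "?p k sums (1 / cosh (real k * ?\<theta>))" by (intro exit_time_gf z) auto
      thus "(\<Sum>n<N. ?p k n) \<le> 1 / cosh (real k * ?\<theta>)"
        unfolding sums_iff using sum_le_suminf[of "?p k" "{..<N}"] pnn by auto
    qed
    also have "\<dots> \<le> pi / 2 / ?\<theta>"
      using sum_sech_upper[OF \<theta>, of N] \<theta> by (simp add: field_simps)
    finally show ?thesis .
  qed
  have part': "(\<Sum>n<N. mean_increment n * z ^ n) \<le> pi / 2 / ?\<theta>" for N
    using part[of N] inn[of N] by (simp)
  show sm: "summable (\<lambda>n. mean_increment n * z ^ n)"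
    by (rule summableI_nonneg_bounded[OF inn part'])
  have "(\<Sum>n. mean_increment n * z ^ n) \<le> pi / 2 / ?\<theta>"
    by (rule suminf_le_const[OF sm part'])
  thus "?\<theta> * (\<Sum>n. mean_increment n * z ^ n) \<le> pi / 2" using \<theta> by (simp add: field_simps)
  have lower: "(\<Sum>k=1..K. 1 / cosh (real k * ?\<theta>)) \<le> (\<Sum>n. mean_increment n * z ^ n)" for K
  proof (rule LIMSEQ_le_const2)
    show "(\<lambda>N. \<Sum>k=1..K. \<Sum>n<N. ?p k n) \<longlonglongrightarrow> (\<Sum>k=1..K. 1 / cosh (real k * ?\<theta>))"
      by (intro tendsto_sum exit_time_gf[OF z, unfolded sums_def]) auto
    have "(\<Sum>k=1..K. \<Sum>n<N. ?p k n) \<le> (\<Sum>n. mean_increment n * z ^ n)" if "N \<ge> K" for N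
    proof -
      have "(\<Sum>k=1..K. \<Sum>n<N. ?p k n) \<le> (\<Sum>k=1..N. \<Sum>n<N. ?p k n)"
        using that pnn by (intro sum_mono2 sum_nonneg) auto
      also have "\<dots> = (\<Sum>n<Suc N. mean_increment n * z ^ n)" by (rule mean_increment_partial_gf[symmetric]) simp
      also have "\<dots> \<le> (\<Sum>n. mean_increment n * z ^ n)" by (rule sum_le_suminf[OF sm]) (use inn in auto)
      finally show ?thesis .
    qed
    thus "\<exists>N0. \<forall>N\<ge>N0. (\<Sum>k=1..K. \<Sum>n<N. ?p k n) \<le> (\<Sum>n. mean_increment n * z ^ n)" by blast
  qed
  show "?\<theta> * (\<Sum>n. mean_increment n * z ^ n) \<ge> pi - 2 * arctan (exp ?\<theta>)"
  proof (rule LIMSEQ_le_const2)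
    have "filterlim (\<lambda>K. exp (real (Suc K) * ?\<theta>)) at_top sequentially" using \<theta> by real_asymp
    from filterlim_compose[OF tendsto_arctan_at_top this]
    have "(\<lambda>K. 2 * arctan (exp (real (Suc K) * ?\<theta>)) - 2 * arctan (exp ?\<theta>)) \<longlonglongrightarrow> 2 * (pi / 2) - 2 * arctan (exp ?\<theta>)"
      by (intro tendsto_intros)
    thus "(\<lambda>K. 2 * arctan (exp (real (Suc K) * ?\<theta>)) - 2 * arctan (exp ?\<theta>)) \<longlonglongrightarrow> pi - 2 * arctan (exp ?\<theta>)"
      by simp
    show "\<exists>N. \<forall>K\<ge>N. 2 * arctan (exp (real (Suc K) * ?\<theta>)) - 2 * arctan (exp ?\<theta>) \<le> ?\<theta> * (\<Sum>n. mean_increment n * z ^ n)"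
      using sum_sech_lower[OF \<theta>] mult_left_mono[OF lower, of ?\<theta>] \<theta> by (meson less_imp_le order_trans)
  qed
qed

lemma mean_increment_laplace_asymp:
  "((\<lambda>t. t powr (1/4) * (\<Sum>n. mean_increment n * exp (- t * real n))) \<longlongrightarrow> 2 powr (-7/4) * pi) (at_right 0)"
proof -
  define \<theta> where "\<theta> t = comb_angle (exp (- t))" for t
  define F where "F t = (\<Sum>n. mean_increment n * exp (- t) ^ n)" for t :: real
  have "((\<lambda>t. \<theta> t * F t) \<longlongrightarrow> pi / 2) (at_right 0)"
  proof (rule tendsto_sandwich)
    show "\<forall>\<^sub>F t in at_right 0. pi - 2 * arctan (exp (\<theta> t)) \<le> \<theta> t * F t"
      unfolding \<theta>_def F_def using eventually_at_right_less[of 0]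
      by eventually_elim (rule mean_increment_gf_bounds; simp)
    show "\<forall>\<^sub>F t in at_right 0. \<theta> t * F t \<le> pi / 2"
      unfolding \<theta>_def F_def using eventually_at_right_less[of 0]
      by eventually_elim (rule mean_increment_gf_bounds; simp)
    have "((\<lambda>t. pi - 2 * arctan (exp (\<theta> t))) \<longlongrightarrow> pi - 2 * arctan (exp 0)) (at_right 0)"
      unfolding \<theta>_def by (intro tendsto_intros comb_angle_tendsto_0)
    thus "((\<lambda>t. pi - 2 * arctan (exp (\<theta> t))) \<longlongrightarrow> pi / 2) (at_right 0)" by (simp add: arctan_one)
  qed simp
  from tendsto_mult[OF comb_angle_asymp this]
  have "((\<lambda>t. t powr (1/4) / \<theta> t * (\<theta> t * F t)) \<longlongrightarrow> 2 powr (-3/4) * (pi / 2)) (at_right 0)"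
    by (simp add: \<theta>_def)
  moreover have "\<forall>\<^sub>F t in at_right 0. t powr (1/4) / \<theta> t * (\<theta> t * F t) = t powr (1/4) * (\<Sum>n. mean_increment n * exp (- t * real n))"
    using eventually_at_right_less[of 0]
  proof eventually_elim
    case (elim t)
    hence "\<theta> t > 0" unfolding \<theta>_def by (intro cosh_comb_angle(2)) auto
    thus ?case by (simp add: F_def mult.commute flip: exp_of_nat_mult)
  qed
  moreover have "2 powr (-3/4) * (pi / 2) = 2 powr (-7/4) * pi"
  proof -
    have "(2::real) powr (-7/4) = 2 powr (-3/4) * 2 powr (-1)" unfolding powr_add[symmetric] by simp
    also have "(2::real) powr (-1) = 1 / 2" by (simp add: powr_minus)
    finally show ?thesis by simp
  qed
  ultimately show ?thesis by (simp add: tendsto_cong)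
qed

theorem theorem4p4:
  fixes M :: "'w measure" and S :: "nat \<Rightarrow> 'w \<Rightarrow> int \<times> int"
  assumes "simple_random_walk M comb_adj (0, 0) S"
  shows "(\<lambda>n. \<integral>\<omega>. real_of_int (max_horizontal S n \<omega>) \<partial>M)
           \<sim>[at_top] (\<lambda>n. 2 powr (- 7 / 4) * pi / Gamma (5 / 4) * real n powr (1 / 4))"
proof -
  define c :: real where "c = 2 powr (- 7 / 4) * pi"
  have "Gamma (5 / 4 :: real) > 0"
    by (rule Gamma_real_pos) simp
  hence c: "c / Gamma (5 / 4) \<noteq> 0"
    unfolding c_def by (metis divide_eq_0_iff mult_eq_0_iff less_irrefl pi_gt_zero powr_gt_zero zero_less_numeral zero_neq_numeral)
  have mean: "(\<integral>\<omega>. real_of_int (max_horizontal S n \<omega>) \<partial>M) = mean_max_abs_fst n" for n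
    unfolding max_horizontal_history mean_max_abs_fst_def by (rule expectation_history[OF assms])
  have "(\<lambda>n. (\<Sum>i\<le>n. mean_increment i) / real n powr (1 / 4)) \<longlonglongrightarrow> c / Gamma (1 + 1 / 4)"
  proof (rule karamata_tauberian)
    fix t :: real assume "t > 0"
    thus "summable (\<lambda>n. mean_increment n * exp (- t * real n))"
      using mean_increment_gf_bounds(1)[of "exp (- t)"] by (simp add: mult.commute flip: exp_of_nat_mult)
  qed (use mean_increment_nonneg mean_increment_laplace_asymp in \<open>simp_all add: c_def\<close>)
  hence "(\<lambda>n. mean_max_abs_fst n / real n powr (1 / 4)) \<longlonglongrightarrow> c / Gamma (5 / 4)"
    by (simp add: sum_mean_increment)
  hence "(\<lambda>n. mean_max_abs_fst n / real n powr (1 / 4) / (c / Gamma (5 / 4))) \<longlonglongrightarrow>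
      c / Gamma (5 / 4) / (c / Gamma (5 / 4))"
    by (rule tendsto_divide[OF _ tendsto_const c])
  hence "(\<lambda>n. mean_max_abs_fst n / (c / Gamma (5 / 4) * real n powr (1 / 4))) \<longlonglongrightarrow> 1"
    unfolding divide_self[OF c] by (simp only: divide_divide_eq_left mult.commute)
  thus ?thesis
    unfolding mean c_def by (rule asymp_equivI')
qed

end
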